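(* Let $m,n$ be positive integers and let $A=(a_{ij})\in\mathbb{R}^{m\times n}$ be a given matrix. Then there exists a unique polynomial $P\in\mathcal{P}_m^n$ satisfying $a_{ij}=P(i,j)$ for all $i=1,\ldots,m$, $j=1,\ldots,n$, and it is given by $$P(x,y)=p_n(x)+\frac{(y-n)}{1!}\nabla p_n(x)+\frac{(y-n)(y-(n-1))}{2!}\nabla^2p_n(x)+\cdots+\frac{(y-n)(y-(n-1))\cdots(y-2)}{(n-1)!}\nabla^{n-1}p_n(x),$$ where $$\nabla^{r}p_n(x)=\sum_{\beta=0}^{r}(-1)^{\beta}\binom{r}{\beta}p_{n-\beta}(x)\quad\text{for all } r=1,2,\ldots,n-1,$$ and, for all $r=1,2,\ldots,n$, $$p_r(x)=a_{mr}+\frac{(x-m)}{1!}\nabla a_{mr}+\frac{(x-m)(x-(m-1))}{2!}\nabla^2a_{mr}+\cdots+\frac{(x-m)(x-(m-1))\cdots(x-2)}{(m-1)!}\nabla^{m-1}a_{mr},$$ where $$\nabla^{k}a_{mr}=\sum_{\alpha=0}^{k}(-1)^{\alpha}\binom{k}{\alpha}a_{(m-\alpha)r}\quad\text{for all } k=1,2,\ldots,m-1.$$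
   Context: For positive integers $m,n$, $\mathcal{P}_m^n$ denotes the real vector space of polynomials in two variables $x,y$ of the form $P(x,y)=\sum_{k_1=0}^{m-1}\sum_{k_2=0}^{n-1}\lambda_{k_1,k_2}x^{k_1}y^{k_2}$ with $\lambda_{k_1,k_2}\in\mathbb{R}$. *)

theory Defs
  imports "Jordan_Normal_Form.Matrix" "HOL-Computational_Algebra.Polynomial"
begin

text \<open>A bivariate polynomial is a \<^typ>\<open>real poly poly\<close>: the outer variable is \<open>y\<close>, and the
  coefficients are polynomials in \<open>x\<close>.\<close>

definition eval2 :: "real poly poly \<Rightarrow> real \<Rightarrow> real \<Rightarrow> real" where
  "eval2 P x y = poly (poly P [:y:]) x"

definition bipoly_space :: "nat \<Rightarrow> nat \<Rightarrow> real poly poly set" where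
  "bipoly_space m n =
     {P. \<exists>c :: nat \<Rightarrow> nat \<Rightarrow> real.
        P = (\<Sum>k1=0..m-1. \<Sum>k2=0..n-1. monom (monom (c k1 k2) k1) k2)}"

lemma eval2_bipoly:
  "eval2 (\<Sum>k1=0..m-1. \<Sum>k2=0..n-1. monom (monom (c k1 k2) k1) k2) x y =
     (\<Sum>k1=0..m-1. \<Sum>k2=0..n-1. c k1 k2 * x ^ k1 * y ^ k2)"
  by (simp add: eval2_def poly_sum poly_monom)

text \<open>Entries counted from 1, whereas \<open>$$\<close> counts from 0.\<close>

definition entry :: "real mat \<Rightarrow> nat \<Rightarrow> nat \<Rightarrow> real" where
  "entry A i j = A $$ (i - 1, j - 1)"

text \<open>The backward difference \<open>\<nabla>\<^sup>k f\<^sub>N\<close>; it is only used for \<open>k < N\<close>, so \<open>N - \<alpha>\<close> stays in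
  \<open>{1..N}\<close>. For \<open>k = 0\<close> it is \<open>f\<^sub>N\<close>.\<close>

definition backward_diff :: "nat \<Rightarrow> (nat \<Rightarrow> real) \<Rightarrow> nat \<Rightarrow> real" where
  "backward_diff k f N = (\<Sum>\<alpha>=0..k. (-1) ^ \<alpha> * real (k choose \<alpha>) * f (N - \<alpha>))"

text \<open>Newton's backward formula on the nodes \<open>1, \<dots>, N\<close>:
  \<open>f\<^sub>N + (z - N)/1! \<nabla>f\<^sub>N + \<dots> + (z - N)(z - (N - 1))\<cdots>(z - 2)/(N - 1)! \<nabla>\<^bsup>N-1\<^esup> f\<^sub>N\<close>.\<close>

definition newton_backward :: "nat \<Rightarrow> (nat \<Rightarrow> real) \<Rightarrow> real \<Rightarrow> real" where
  "newton_backward N f z =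
     (\<Sum>k=0..N-1. (\<Prod>t<k. z - real (N - t)) / fact k * backward_diff k f N)"

definition column_poly :: "real mat \<Rightarrow> nat \<Rightarrow> nat \<Rightarrow> real \<Rightarrow> real" where
  "column_poly A m r x = newton_backward m (\<lambda>i. entry A i r) x"

end

theory Submission
  imports Defs
begin

text \<open>
  In one variable, Newton's backward formula is the operator identity
  \<open>E\<^bsup>-s\<^esup> = (1 - \<nabla>)\<^sup>s\<close>, where \<open>E\<^bsup>-1\<^esup>\<close> is the shift \<open>f\<^sub>N \<mapsto> f\<^bsub>N-1\<^esub>\<close>: at the node \<open>z = N - s\<close> the
  factor \<open>(z - N)\<cdots>(z - (N - k + 1)) / k!\<close> is \<open>(-1)\<^sup>k (s choose k)\<close>, so the formula takes the value
  \<open>f\<^bsub>N-s\<^esub>\<close> there (\<open>newton_backward_node\<close>). As a function of \<open>z\<close> it is a polynomial of degree below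
  \<open>N\<close>. Two such polynomials that agree on \<open>N\<close> nodes are equal, so the formula reproduces every
  polynomial of degree below \<open>N\<close> from its values on the nodes (\<open>newton_backward_reproduces\<close>).

  In two variables both halves follow by treating one variable at a time. If \<open>P\<close> lies in the space
  and interpolates \<open>A\<close>, then for fixed \<open>x\<close> the map \<open>y \<mapsto> P(x, y)\<close> is reproduced from the values
  \<open>P(x, r)\<close> with \<open>1 \<le> r \<le> n\<close>, and each \<open>x \<mapsto> P(x, r)\<close> is reproduced from the values \<open>P(i, r) = a\<^bsub>ir\<^esub>\<close>;
  hence \<open>P(x, y)\<close> is the nested Newton formula. In particular all interpolants agree as functions
  on the plane, and a bivariate polynomial over \<open>\<real>\<close> is determined by its function
  (\<open>eval2_inject\<close>), which gives uniqueness. For existence, the columns are interpolated in \<open>x\<close>, and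
  then, for each power of \<open>x\<close>, its coefficients in these \<open>n\<close> column polynomials are interpolated
  in \<open>y\<close>.
\<close>

section \<open>Backward differences\<close>

lemma backward_diff_cong:
  assumes "k < N" and "\<And>i. i \<in> {1..N} \<Longrightarrow> f i = g i"
  shows "backward_diff k f N = backward_diff k g N"
  unfolding backward_diff_def using assms by (intro sum.cong) auto

lemma newton_backward_cong:
  assumes "N \<ge> 1" and "\<And>i. i \<in> {1..N} \<Longrightarrow> f i = g i"
  shows "newton_backward N f z = newton_backward N g z"
  unfolding newton_backward_def
proof (rule sum.cong)
  fix k assume "k \<in> {0..N - 1}"
  then have "k < N" using \<open>N \<ge> 1\<close> by auto
  then have "backward_diff k f N = backward_diff k g N"
    using assms(2) by (rule backward_diff_cong)
  then show "(\<Prod>t<k. z - real (N - t)) / fact k * backward_diff k f N =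
        (\<Prod>t<k. z - real (N - t)) / fact k * backward_diff k g N" by simp
qed simp

text \<open>
  Pascal's rule for alternating sums. It serves twice: with \<open>g a = f (N - a)\<close> it is the recursion
  for \<open>\<nabla>\<close>, and with \<open>g a = \<nabla>\<^sup>a f\<^sub>N\<close> it is the induction step for \<open>(1 - \<nabla>)\<^sup>s\<close>.
\<close>

lemma sum_alternating_Pascal:
  fixes g :: "nat \<Rightarrow> real"
  shows "(\<Sum>a=0..Suc k. (-1) ^ a * real (Suc k choose a) * g a) =
    (\<Sum>a=0..k. (-1) ^ a * real (k choose a) * g a) -
    (\<Sum>a=0..k. (-1) ^ a * real (k choose a) * g (Suc a))"
proof -
  have "(\<Sum>a=0..Suc k. (-1) ^ a * real (Suc k choose a) * g a) =
      g 0 + (\<Sum>a=0..k. (-1) ^ Suc a * real (Suc k choose Suc a) * g (Suc a))"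
    by (subst sum.atLeast0_atMost_Suc_shift) simp
  also have "\<dots> = (g 0 + (\<Sum>a=0..k. (-1) ^ Suc a * real (k choose Suc a) * g (Suc a))) -
      (\<Sum>a=0..k. (-1) ^ a * real (k choose a) * g (Suc a))"
    by (simp add: algebra_simps sum.distrib sum_negf sum_subtractf)
  also have "g 0 + (\<Sum>a=0..k. (-1) ^ Suc a * real (k choose Suc a) * g (Suc a)) =
      (\<Sum>a=0..Suc k. (-1) ^ a * real (k choose a) * g a)"
    by (subst sum.atLeast0_atMost_Suc_shift) simp
  also have "\<dots> = (\<Sum>a=0..k. (-1) ^ a * real (k choose a) * g a)"
    by simp
  finally show ?thesis .
qed

text \<open>
  Truncated subtraction satisfies \<open>(N - 1) - \<alpha> = N - (\<alpha> + 1)\<close>, so the recursion survives the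
  convention for indices below \<open>0\<close>.
\<close>

lemma backward_diff_Suc:
  "backward_diff (Suc k) f N = backward_diff k f N - backward_diff k f (N - 1)"
  unfolding backward_diff_def
  using sum_alternating_Pascal[of k "\<lambda>a. f (N - a)"] by simp

text \<open>
  This is the expansion of \<open>(1 - \<nabla>)\<^sup>s\<close>, which is the shift by \<open>s\<close> steps; the induction multiplies
  by one more factor \<open>1 - \<nabla>\<close>.
\<close>

lemma sum_binomial_backward_diff:
  "(\<Sum>k=0..s. (-1) ^ k * real (s choose k) * backward_diff k f N) = f (N - s)"
proof (induction s arbitrary: N)
  case 0
  then show ?case by (simp add: backward_diff_def)
next
  case (Suc s)
  have "(\<Sum>k=0..Suc s. (-1) ^ k * real (Suc s choose k) * backward_diff k f N) =
      (\<Sum>k=0..s. (-1) ^ k * real (s choose k) * backward_diff k f (N - 1))"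
    by (simp only: sum_alternating_Pascal backward_diff_Suc)
       (simp add: algebra_simps sum_subtractf)
  also have "\<dots> = f (N - 1 - s)" by (rule Suc.IH)
  finally show ?case by simp
qed

section \<open>Interpolation in one variable\<close>

lemma prod_neg_falling:
  "(\<Prod>t<k. real t - real s) / fact k = (-1) ^ k * real (s choose k)"
proof -
  have "(\<Prod>t<k. real t - real s) = (\<Prod>t<k. - (real s - real t))" by simp
  also have "\<dots> = (-1) ^ k * (\<Prod>t<k. real s - real t)"
    by (simp only: prod_uminus card_lessThan)
  also have "(\<Prod>t<k. real s - real t) = fact k * real (s choose k)"
    by (simp add: binomial_gbinomial gbinomial_prod_rev atLeast0LessThan)
  finally show ?thesis by simp
qed

lemma newton_backward_node:
  assumes "i \<in> {1..N}"
  shows "newton_backward N f (real i) = f i"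
proof -
  define s where "s = N - i"
  have s: "i = N - s" "s \<le> N - 1" using assms by (auto simp: s_def)
  have "newton_backward N f (real i) =
      (\<Sum>k=0..N-1. (-1) ^ k * real (s choose k) * backward_diff k f N)"
    unfolding newton_backward_def
  proof (rule sum.cong)
    fix k assume k: "k \<in> {0..N - 1}"
    have "(\<Prod>t<k. real i - real (N - t)) = (\<Prod>t<k. real t - real s)"
      using k assms by (intro prod.cong) (auto simp: s_def)
    then show "(\<Prod>t<k. real i - real (N - t)) / fact k * backward_diff k f N =
        (-1) ^ k * real (s choose k) * backward_diff k f N"
      by (simp add: prod_neg_falling)
  qed simp
  \<comment> \<open>The binomials vanish for \<open>k > s\<close>, so all orders up to \<open>N - 1\<close> may be included at every node.\<close>
  also have "\<dots> = (\<Sum>k=0..s. (-1) ^ k * real (s choose k) * backward_diff k f N)"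
    using s by (intro sum.mono_neutral_right) auto
  also have "\<dots> = f i" by (simp add: sum_binomial_backward_diff s(1))
  finally show ?thesis .
qed

definition newton_poly :: "nat \<Rightarrow> (nat \<Rightarrow> real) \<Rightarrow> real poly" where
  "newton_poly N f = (\<Sum>k=0..N-1. smult (backward_diff k f N / fact k)
     (\<Prod>t<k. [:- real (N - t), 1:]))"

lemma poly_newton_poly: "poly (newton_poly N f) z = newton_backward N f z"
  by (simp add: newton_poly_def newton_backward_def poly_sum poly_prod mult.commute del: of_nat_diff)

lemma degree_newton_poly: "degree (newton_poly N f) \<le> N - 1"
  unfolding newton_poly_def
proof (rule degree_sum_le)
  fix k assume "k \<in> {0..N - 1}"
  moreover have "degree (\<Prod>t<k. [:- real (N - t), 1:]) \<le> k"
    using degree_prod_sum_le[of "{..<k}" "\<lambda>t. [:- real (N - t), 1:]"] by simp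
  ultimately show "degree (smult (backward_diff k f N / fact k) (\<Prod>t<k. [:- real (N - t), 1:])) \<le> N - 1"
    by (auto intro: order_trans[OF degree_smult_le])
qed simp

lemma newton_backward_reproduces:
  assumes "N \<ge> 1" and "degree p \<le> N - 1"
  shows "newton_backward N (\<lambda>i. poly p (real i)) z = poly p z"
proof -
  have card: "card (real ` {1..N}) = N"
    by (simp add: card_image)
  have "newton_poly N (\<lambda>i. poly p (real i)) = p"
  proof (rule poly_eqI_degree)
    show "poly (newton_poly N (\<lambda>i. poly p (real i))) x = poly p x" if "x \<in> real ` {1..N}" for x
      using that by (auto simp: poly_newton_poly newton_backward_node)
    show "card (real ` {1..N}) > degree (newton_poly N (\<lambda>i. poly p (real i)))"
      using degree_newton_poly[of N "\<lambda>i. poly p (real i)"] \<open>N \<ge> 1\<close> unfolding card by linarith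
    show "card (real ` {1..N}) > degree p"
      using assms unfolding card by linarith
  qed
  then show ?thesis by (metis poly_newton_poly)
qed

lemma poly_sum_upto_degree_bound:
  fixes p :: "real poly"
  assumes "degree p \<le> d"
  shows "poly p z = (\<Sum>k=0..d. coeff p k * z ^ k)"
proof -
  have "(\<Sum>k\<le>degree p. coeff p k * z ^ k) = (\<Sum>k=0..d. coeff p k * z ^ k)"
    using assms by (intro sum.mono_neutral_left) (auto simp: coeff_eq_0)
  then show ?thesis by (simp add: poly_altdef)
qed

lemma newton_backward_reproduces_sum:
  assumes "N \<ge> 1" and f: "\<And>z. f z = (\<Sum>k=0..N-1. c k * z ^ k)"
  shows "newton_backward N (\<lambda>i. f (real i)) z = f z"
proof -
  define p where "p = (\<Sum>k=0..N-1. monom (c k) k)"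
  have "f = poly p"
    by (auto simp: p_def f poly_sum poly_monom)
  moreover have "degree p \<le> N - 1"
    unfolding p_def by (rule degree_sum_le) (auto intro: order_trans[OF degree_monom_le])
  ultimately show ?thesis using newton_backward_reproduces[OF \<open>N \<ge> 1\<close>] by simp
qed

section \<open>Interpolation in two variables\<close>

text \<open>
  Equality of functions first gives \<open>P(\<cdot>, y) = Q(\<cdot>, y)\<close> as polynomials in \<open>x\<close>; thus \<open>P - Q\<close>,
  a polynomial over the domain \<open>\<real>[x]\<close>, has every constant \<open>y\<close> as a root, and only \<open>0\<close>
  has infinitely many roots.
\<close>

lemma eval2_inject:
  assumes "\<And>x y. eval2 P x y = eval2 Q x y"
  shows "P = Q"
proof (rule ccontr)
  assume "P \<noteq> Q"
  have "poly P [:y:] = poly Q [:y:]" for y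
    using assms by (simp add: eval2_def poly_eq_poly_eq_iff[symmetric] fun_eq_iff)
  then have "range (\<lambda>y. [:y:]) \<subseteq> {q. poly (P - Q) q = 0}" by auto
  moreover have "finite {q. poly (P - Q) q = 0}"
    using \<open>P \<noteq> Q\<close> by (intro poly_roots_finite) simp
  ultimately have "finite (range (\<lambda>y :: real. [:y:]))" by (rule finite_subset)
  moreover have "inj (\<lambda>y :: real. [:y:])" by (auto intro: injI)
  ultimately have "finite (UNIV :: real set)" by (rule finite_imageD)
  then show False by (simp add: infinite_UNIV_char_0)
qed

lemma eval2_eq_nested_newton:
  assumes "m \<ge> 1" "n \<ge> 1" "P \<in> bipoly_space m n"
    and interp: "\<forall>i\<in>{1..m}. \<forall>j\<in>{1..n}. entry A i j = eval2 P (real i) (real j)"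
  shows "eval2 P x y = newton_backward n (\<lambda>r. column_poly A m r x) y"
proof -
  obtain c where P: "P = (\<Sum>k1=0..m-1. \<Sum>k2=0..n-1. monom (monom (c k1 k2) k1) k2)"
    using assms(3) by (auto simp: bipoly_space_def)
  have in_x: "eval2 P x y = (\<Sum>k1=0..m-1. (\<Sum>k2=0..n-1. c k1 k2 * y ^ k2) * x ^ k1)" for x y
    unfolding P eval2_bipoly by (simp add: sum_distrib_left sum_distrib_right ac_simps)
  have in_y: "eval2 P x y = (\<Sum>k2=0..n-1. (\<Sum>k1=0..m-1. c k1 k2 * x ^ k1) * y ^ k2)" for x y
    unfolding P eval2_bipoly by (subst sum.swap) (simp add: sum_distrib_right)
  have column: "eval2 P x (real r) = column_poly A m r x" if "r \<in> {1..n}" for r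
  proof -
    have "eval2 P x (real r) = newton_backward m (\<lambda>i. eval2 P (real i) (real r)) x"
      using newton_backward_reproduces_sum[OF \<open>m \<ge> 1\<close> in_x] by simp
    also have "\<dots> = column_poly A m r x"
      unfolding column_poly_def using that interp \<open>m \<ge> 1\<close> by (intro newton_backward_cong) auto
    finally show ?thesis .
  qed
  have "eval2 P x y = newton_backward n (\<lambda>r. eval2 P x (real r)) y"
    using newton_backward_reproduces_sum[OF \<open>n \<ge> 1\<close> in_y] by simp
  also have "\<dots> = newton_backward n (\<lambda>r. column_poly A m r x) y"
    using column \<open>n \<ge> 1\<close> by (intro newton_backward_cong) auto
  finally show ?thesis .
qed

text \<open>
  The coefficient of \<open>x\<^bsup>k1\<^esup> y\<^bsup>k2\<^esup>\<close> is that of \<open>y\<^bsup>k2\<^esup>\<close> in the interpolant of the \<open>k1\<close>-th coefficients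
  of the column polynomials; for \<open>y = j\<close> this collapses to the \<open>j\<close>-th column polynomial.
\<close>

lemma bipoly_interpolant_exists:
  assumes "m \<ge> 1" "n \<ge> 1"
  shows "\<exists>P\<in>bipoly_space m n.
    \<forall>i\<in>{1..m}. \<forall>j\<in>{1..n}. a i j = eval2 P (real i) (real j)"
proof -
  define col where "col r = newton_poly m (\<lambda>i. a i r)" for r
  define c where "c k1 k2 = coeff (newton_poly n (\<lambda>r. coeff (col r) k1)) k2" for k1 k2
  define P where "P = (\<Sum>k1=0..m-1. \<Sum>k2=0..n-1. monom (monom (c k1 k2) k1) k2)"
  have "a i j = eval2 P (real i) (real j)" if i: "i \<in> {1..m}" and j: "j \<in> {1..n}" for i j
  proof -
    have c_at_j: "(\<Sum>k2=0..n-1. c k1 k2 * real j ^ k2) = coeff (col j) k1" for k1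
      using poly_sum_upto_degree_bound[OF degree_newton_poly, of n "\<lambda>r. coeff (col r) k1" "real j"] j
      by (simp add: c_def poly_newton_poly newton_backward_node)
    have "eval2 P (real i) (real j) =
        (\<Sum>k1=0..m-1. (\<Sum>k2=0..n-1. c k1 k2 * real j ^ k2) * real i ^ k1)"
      unfolding P_def eval2_bipoly by (simp add: sum_distrib_left sum_distrib_right ac_simps)
    also have "\<dots> = poly (col j) (real i)"
      using poly_sum_upto_degree_bound[OF degree_newton_poly, of m "\<lambda>i. a i j" "real i"]
      by (simp only: c_at_j col_def)
    also have "\<dots> = a i j" using i by (simp add: col_def poly_newton_poly newton_backward_node)
    finally show ?thesis by simp
  qed
  moreover have "P \<in> bipoly_space m n" by (auto simp: P_def bipoly_space_def)
  ultimately show ?thesis by blast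
qed

theorem theorem3p4:
  fixes m n :: nat and A :: "real mat"
  assumes "m \<ge> 1" and "n \<ge> 1" and "A \<in> carrier_mat m n"
  shows "(\<exists>!P. P \<in> bipoly_space m n \<and>
            (\<forall>i\<in>{1..m}. \<forall>j\<in>{1..n}. entry A i j = eval2 P (real i) (real j))) \<and>
         (\<forall>P. P \<in> bipoly_space m n \<and>
            (\<forall>i\<in>{1..m}. \<forall>j\<in>{1..n}. entry A i j = eval2 P (real i) (real j)) \<longrightarrow>
            (\<forall>x y. eval2 P x y = newton_backward n (\<lambda>r. column_poly A m r x) y))"
proof -
  let ?interp = "\<lambda>P. P \<in> bipoly_space m n \<and>
    (\<forall>i\<in>{1..m}. \<forall>j\<in>{1..n}. entry A i j = eval2 P (real i) (real j))"
  have formula: "eval2 P x y = newton_backward n (\<lambda>r. column_poly A m r x) y"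
    if "?interp P" for P x y
    using that by (intro eval2_eq_nested_newton[OF assms(1,2)]) auto
  have "\<exists>P. ?interp P"
    using bipoly_interpolant_exists[OF assms(1,2), of "entry A"] by blast
  moreover have "P = Q" if "?interp P" "?interp Q" for P Q
    by (rule eval2_inject) (simp only: formula[OF that(1)] formula[OF that(2)])
  ultimately have "\<exists>!P. ?interp P" by blast
  then show ?thesis using formula by blast
qed

end
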